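(* Let $(X,\mathcal S)$ be a $T_0$ Pervin space. Then: (a) $(X,\mathcal S)$ is complete if and only if for every $T_0$ Pervin space $(Y,\mathcal T)$ and every morphism of Pervin spaces $f:(X,\mathcal S)\to(Y,\mathcal T)$ such that $\mathbf L_{\rm Pervin}(f)$ is an isomorphism of lattices, $f$ is an isomorphism of Pervin spaces. (b) $(X,\mathcal S)$ is $T_D$ if and only if for every $T_0$ Pervin space $(Y,\mathcal T)$ and every morphism of Pervin spaces $f:(Y,\mathcal T)\to(X,\mathcal S)$ such that $\mathbf L_{\rm Pervin}(f)$ is an isomorphism of lattices, $f$ is an isomorphism of Pervin spaces.
   Context: A Pervin space is a pair $(X,\mathcal S)$ with $X$ a set and $\mathcal S$ a bounded sublattice of $\mathcal P(X)$. A morphism $(X,\mathcal S)\to(Y,\mathcal T)$ is a function $f$ with $f^{-1}(T)\in\mathcal S$ for all $T\in\mathcal T$. For such $f$, $\mathbf L_{\rm Pervin}(f):\mathcal T\to\mathcal S$ is the lattice homomorphism $T\mapsto f^{-1}(T)$. $\Omega_{\mathcal S}(X)$ is the topology generated by $\mathcal S$; $(X,\mathcal S)$ is $T_0$ if this topology is $T_0$. $f$ is dense if $f[X]$ is dense in $(Y,\Omega_{\mathcal T}(Y))$; it is an extremal monomorphism if and only if it is injective and every $S\in\mathcal S$ is $f^{-1}(T)$ for some $T\in\mathcal T$; it is an isomorphism if and only if it is a bijection with $f[\mathcal S]=\mathcal T$. $(X,\mathcal S)$ is symmetric if $\mathcal S$ is a Boolean algebra. A symmetric Pervin space is complete if every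 dense extremal monomorphism from it into a $T_0$ symmetric Pervin space is an isomorphism. A Pervin space $(X,\mathcal S)$ is complete if $(X,\overline{\mathcal S})$ is complete, where $\overline{\mathcal S}$ is the Boolean subalgebra of $\mathcal P(X)$ generated by $\mathcal S$. A Pervin space $(X,\mathcal S)$ is $T_D$ if for every $x\in X$ there is $S\in\mathcal S$ such that $x\in S$ and $S\setminus\{x\}\in\mathcal S$. *)

theory Defs
  imports "HOL-Analysis.Analysis"
begin

text \<open>
  The carrier of a Pervin space is an arbitrary, possibly empty, subset of a type, and a map
  between Pervin spaces is a HOL function of which only the values on the carrier matter.
  Preimages are therefore cut down to the carrier.
\<close>

definition pervin_space :: "'a set \<Rightarrow> 'a set set \<Rightarrow> bool" where
  "pervin_space X S \<longleftrightarrow>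
     S \<subseteq> Pow X \<and> {} \<in> S \<and> X \<in> S \<and> (\<forall>A\<in>S. \<forall>B\<in>S. A \<union> B \<in> S \<and> A \<inter> B \<in> S)"

definition pervin_morphism ::
    "'a set \<Rightarrow> 'a set set \<Rightarrow> 'b set \<Rightarrow> 'b set set \<Rightarrow> ('a \<Rightarrow> 'b) \<Rightarrow> bool" where
  "pervin_morphism X S Y T f \<longleftrightarrow> f \<in> X \<rightarrow> Y \<and> (\<forall>B\<in>T. f -` B \<inter> X \<in> S)"

definition L_Pervin :: "'a set \<Rightarrow> ('a \<Rightarrow> 'b) \<Rightarrow> 'b set \<Rightarrow> 'a set" where
  "L_Pervin X f B = f -` B \<inter> X"

definition set_lattice_iso :: "'b set set \<Rightarrow> 'a set set \<Rightarrow> ('b set \<Rightarrow> 'a set) \<Rightarrow> bool" where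
  "set_lattice_iso T S h \<longleftrightarrow>
     bij_betw h T S \<and> (\<forall>A\<in>T. \<forall>B\<in>T. h (A \<union> B) = h A \<union> h B \<and> h (A \<inter> B) = h A \<inter> h B)"

text \<open>
  The topology of a Pervin space \<open>(X, S)\<close> is \<open>topology_generated_by S\<close>; its underlying set is
  \<open>\<Union>S = X\<close>, since \<open>X \<in> S\<close>.
\<close>

definition pervin_T0 :: "'a set \<Rightarrow> 'a set set \<Rightarrow> bool" where
  "pervin_T0 X S \<longleftrightarrow> pervin_space X S \<and> t0_space (topology_generated_by S)"

definition pervin_dense ::
    "'a set \<Rightarrow> 'a set set \<Rightarrow> 'b set \<Rightarrow> 'b set set \<Rightarrow> ('a \<Rightarrow> 'b) \<Rightarrow> bool" where
  "pervin_dense X S Y T f \<longleftrightarrow>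
     pervin_morphism X S Y T f \<and> topology_generated_by T closure_of (f ` X) = Y"

definition pervin_extremal_mono ::
    "'a set \<Rightarrow> 'a set set \<Rightarrow> 'b set \<Rightarrow> 'b set set \<Rightarrow> ('a \<Rightarrow> 'b) \<Rightarrow> bool" where
  "pervin_extremal_mono X S Y T f \<longleftrightarrow>
     pervin_morphism X S Y T f \<and> inj_on f X \<and> (\<forall>A\<in>S. \<exists>B\<in>T. A = f -` B \<inter> X)"

definition pervin_iso ::
    "'a set \<Rightarrow> 'a set set \<Rightarrow> 'b set \<Rightarrow> 'b set set \<Rightarrow> ('a \<Rightarrow> 'b) \<Rightarrow> bool" where
  "pervin_iso X S Y T f \<longleftrightarrow> pervin_morphism X S Y T f \<and> bij_betw f X Y \<and> (`) f ` S = T"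

text \<open>
  The locale predicate \<^const>\<open>algebra\<close> says that its second argument is a Boolean subalgebra of the
  powerset of the first.
\<close>

definition pervin_symmetric :: "'a set \<Rightarrow> 'a set set \<Rightarrow> bool" where
  "pervin_symmetric X S \<longleftrightarrow> pervin_space X S \<and> algebra X S"

text \<open>
  HOL cannot quantify over types, so the space \<open>(Y, T)\<close> has its carrier in one fixed type. The type
  \<open>'a set set\<close> loses nothing: a point \<open>y\<close> of a \<open>T\<^sub>0\<close> space that receives a map from \<open>(X, S)\<close> which is
  dense and extremal mono is determined by the set of preimages of its neighbourhoods in \<open>T\<close>. Lemma
  \<open>pervin_complete_symmetric_any_type\<close> below proves that the condition then holds for spaces with
  carriers in any type.
\<close>

definition pervin_complete_symmetric :: "'a set \<Rightarrow> 'a set set \<Rightarrow> bool" where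
  "pervin_complete_symmetric X S \<longleftrightarrow>
     (\<forall>(Y :: 'a set set set) T f.
        pervin_T0 Y T \<and> pervin_symmetric Y T \<and>
        pervin_dense X S Y T f \<and> pervin_extremal_mono X S Y T f \<longrightarrow> pervin_iso X S Y T f)"

definition pervin_symmetrization :: "'a set \<Rightarrow> 'a set set \<Rightarrow> 'a set set" where
  "pervin_symmetrization X S = algebra X hull S"

definition pervin_complete :: "'a set \<Rightarrow> 'a set set \<Rightarrow> bool" where
  "pervin_complete X S \<longleftrightarrow> pervin_complete_symmetric X (pervin_symmetrization X S)"

definition pervin_TD :: "'a set \<Rightarrow> 'a set set \<Rightarrow> bool" where
  "pervin_TD X S \<longleftrightarrow> (\<forall>x\<in>X. \<exists>A\<in>S. x \<in> A \<and> A - {x} \<in> S)"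

text \<open>
  Carriers of test spaces for a space over \<open>'a\<close>. The first summand makes the type large enough for
  the characterisations to hold (it has room for the prime filters of any lattice of subsets of
  \<open>'a\<close>). The second one is a free type parameter, so that a theorem about all spaces with carrier in
  this type covers all spaces with carrier in an arbitrary type.
\<close>

type_synonym ('a, 'u) test_type = "'a set set + 'u"


subsection \<open>Completeness does not depend on the type of the carriers\<close>

lemma pervin_space_Union: "pervin_space X S \<Longrightarrow> \<Union>S = X"
  by (auto simp: pervin_space_def)

lemma pervin_T0_separate:
  assumes "pervin_T0 Y T" "x \<in> Y" "y \<in> Y" "\<forall>B\<in>T. x \<in> B \<longleftrightarrow> y \<in> B"
  shows "x = y"
proof (rule ccontr)
  assume "x \<noteq> y"
  moreover have top: "topspace (topology_generated_by T) = Y"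
    using assms(1) by (auto simp: pervin_T0_def pervin_space_Union)
  ultimately obtain U where U: "openin (topology_generated_by T) U" "(x \<notin> U) = (y \<in> U)"
    using assms(1-3) unfolding pervin_T0_def t0_space_def by metis
  have "generate_topology_on T U"
    using U(1) by (simp add: openin_topology_generated_by_iff)
  then have "x \<in> U \<longleftrightarrow> y \<in> U"
    by induction (use assms(4) in auto)
  with U(2) show False by auto
qed

lemma pervin_transport:
  assumes "pervin_space Y T" "inj_on p Y"
  defines "Y' \<equiv> p ` Y" and "T' \<equiv> (`) p ` T"
  shows "pervin_space Y' T'"
    and "homeomorphic_map (topology_generated_by T) (topology_generated_by T') p"
    and "pervin_symmetric Y T \<Longrightarrow> pervin_symmetric Y' T'"
proof -
  have sub: "B \<subseteq> Y" if "B \<in> T" for B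
    using assms(1) that by (auto simp: pervin_space_def)
  have un: "p ` A \<union> p ` B = p ` (A \<union> B)" for A B
    by auto
  have int: "p ` A \<inter> p ` B = p ` (A \<inter> B)" if "A \<in> T" "B \<in> T" for A B
    using inj_on_image_Int[OF assms(2)] sub that by auto
  show ps: "pervin_space Y' T'"
    using assms(1) sub by (auto simp: pervin_space_def Y'_def T'_def un int)
  have vim: "p -` (p ` B) \<inter> Y = B" if "B \<in> T" for B
    using assms(2) sub[OF that] by (auto simp: inj_on_def)
  have tops: "topspace (topology_generated_by T) = Y" "topspace (topology_generated_by T') = Y'"
    using pervin_space_Union assms(1) ps by auto
  define q where "q = inv_into Y p"
  have vim': "q -` B \<inter> Y' = p ` B" if "B \<in> T" for B
    using assms(2) sub[OF that] by (force simp: q_def Y'_def image_iff)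
  have "continuous_map (topology_generated_by T) (topology_generated_by T') p"
    unfolding continuous_on_generated_topo_iff
    using vim pervin_space_Union[OF ps] tops
    by (auto simp: T'_def Y'_def topology_generated_by_Basis)
  moreover have "continuous_map (topology_generated_by T') (topology_generated_by T) q"
    unfolding continuous_on_generated_topo_iff
    using vim' pervin_space_Union[OF assms(1)] tops assms(2)
    by (auto simp: T'_def Y'_def topology_generated_by_Basis q_def)
  ultimately have "homeomorphic_maps (topology_generated_by T) (topology_generated_by T') p q"
    unfolding homeomorphic_maps_def tops using assms(2) by (auto simp: q_def Y'_def f_inv_into_f)
  then show "homeomorphic_map (topology_generated_by T) (topology_generated_by T') p"
    by (rule homeomorphic_maps_imp_map)
  show "pervin_symmetric Y' T'" if "pervin_symmetric Y T"
  proof -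
    have "p ` Y - p ` B = p ` (Y - B)" if "B \<in> T" for B
      using inj_on_image_set_diff[OF assms(2), of Y B] sub[OF that] by auto
    then show ?thesis
      using that ps by (auto simp: pervin_symmetric_def pervin_space_def algebra_iff_Un Y'_def T'_def)
  qed
qed

lemma pervin_complete_symmetric_any_type:
  fixes X :: "'a set" and Y :: "'b set"
  assumes "pervin_complete_symmetric X S" "pervin_T0 Y T" "pervin_symmetric Y T"
    and "pervin_dense X S Y T f" "pervin_extremal_mono X S Y T f"
  shows "pervin_iso X S Y T f"
proof -
  define p :: "'b \<Rightarrow> 'a set set" where "p y = {f -` B \<inter> X | B. B \<in> T \<and> y \<in> B}" for y
  have ps: "pervin_space Y T" and mor: "pervin_morphism X S Y T f"
    using assms by (auto simp: pervin_T0_def pervin_dense_def)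
  have sub: "B \<subseteq> Y" if "B \<in> T" for B
    using ps that by (auto simp: pervin_space_def)
  have empty: "D = {}" if "D \<in> T" "f -` D \<inter> X = {}" for D
  proof (rule ccontr)
    assume "D \<noteq> {}"
    then obtain y where y: "y \<in> D" by auto
    then have "y \<in> topology_generated_by T closure_of (f ` X)"
      using assms(4) sub[OF that(1)] by (auto simp: pervin_dense_def)
    then have "\<exists>z\<in>f ` X. z \<in> D"
      unfolding closure_of_def using y topology_generated_by_Basis[OF that(1)] by blast
    with that(2) show False by auto
  qed
  have le: "B \<subseteq> C" if BC: "B \<in> T" "C \<in> T" "f -` B \<inter> X = f -` C \<inter> X" for B C
  proof -
    have "Y - C \<in> T" 
      using assms(3) BC(2) by (auto simp: pervin_symmetric_def algebra_iff_Un)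
    then have "B \<inter> (Y - C) \<in> T"
      using ps BC(1) by (auto simp: pervin_space_def)
    moreover have "f -` (B \<inter> (Y - C)) \<inter> X = {}"
      using BC(3) by auto
    ultimately have "B \<inter> (Y - C) = {}"
      by (rule empty)
    then show ?thesis
      using sub[OF BC(1)] by auto
  qed
  have inj: "inj_on p Y"
  proof (rule inj_onI)
    fix x y assume xy: "x \<in> Y" "y \<in> Y" "p x = p y"
    have "y \<in> B" if "B \<in> T" "x \<in> B" "p x = p y" for x y B
    proof -
      have "f -` B \<inter> X \<in> p y" using that unfolding p_def by blast
      then obtain C where "C \<in> T" "y \<in> C" "f -` B \<inter> X = f -` C \<inter> X"
        unfolding p_def by auto
      then show ?thesis using le[of C B] that(1) by auto
    qed
    then have "\<forall>B\<in>T. x \<in> B \<longleftrightarrow> y \<in> B"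
      using xy(3) by metis
    then show "x = y"
      using pervin_T0_separate[OF assms(2)] xy by blast
  qed
  define Y' T' where "Y' = p ` Y" and "T' = (`) p ` T"
  note tr = pervin_transport[OF ps inj, folded Y'_def T'_def]
  have fXY: "f ` X \<subseteq> Y"
    using mor by (auto simp: pervin_morphism_def)
  have vim: "(p \<circ> f) -` (p ` B) \<inter> X = f -` B \<inter> X" if "B \<in> T" for B
    using inj fXY sub[OF that] by (auto simp: inj_on_def subset_iff image_iff) blast
  have "pervin_T0 Y' T'"
    using tr(1) homeomorphic_t0_space[OF homeomorphic_map_imp_homeomorphic_space[OF tr(2)]] assms(2)
    by (auto simp: pervin_T0_def)
  moreover have "pervin_symmetric Y' T'"
    using tr(3) assms(3) by blast
  moreover have mor': "pervin_morphism X S Y' T' (p \<circ> f)"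
    using mor vim by (auto simp: pervin_morphism_def T'_def Y'_def)
  moreover have "pervin_dense X S Y' T' (p \<circ> f)"
  proof -
    have "topology_generated_by T' closure_of (p ` f ` X)
        = p ` (topology_generated_by T closure_of (f ` X))"
      using homeomorphic_map_closure_of[OF tr(2), of "f ` X"] fXY pervin_space_Union[OF ps] by auto
    then show ?thesis
      using assms(4) mor' by (auto simp: pervin_dense_def Y'_def image_comp)
  qed
  moreover have "pervin_extremal_mono X S Y' T' (p \<circ> f)"
    using assms(5) mor' vim comp_inj_on[of f X p] inj_on_subset[OF inj fXY]
    by (auto simp: pervin_extremal_mono_def T'_def)
  ultimately have iso: "pervin_iso X S Y' T' (p \<circ> f)"
    using assms(1) unfolding pervin_complete_symmetric_def by blast
  have SX: "A \<subseteq> X" if "A \<in> S" for A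
    using assms(5) that by (auto simp: pervin_extremal_mono_def)
  have "f ` X = Y"
  proof -
    have "p ` f ` X = p ` Y"
      using iso by (auto simp: pervin_iso_def bij_betw_def Y'_def image_comp)
    then show ?thesis
      using inj fXY by (simp add: inj_on_image_eq_iff)
  qed
  moreover have "(`) f ` S = T"
  proof -
    have eq: "(`) p ` ((`) f ` S) = (`) p ` T"
      using iso by (simp add: pervin_iso_def T'_def image_comp comp_def)
    have "inj_on ((`) p) (Pow Y)"
      using inj by (rule inj_on_image_Pow)
    moreover have "(`) f ` S \<subseteq> Pow Y" "T \<subseteq> Pow Y"
      using SX fXY sub by blast+
    ultimately show ?thesis
      using eq inj_on_image_eq_iff by metis
  qed
  ultimately show ?thesis
    using mor assms(5) by (auto simp: pervin_iso_def bij_betw_def pervin_extremal_mono_def)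
qed

end

theory Submission
  imports Defs
begin

text \<open>
  For a \<open>T\<^sub>0\<close> domain, a morphism \<open>f\<close> whose preimage map is a bijection of lattices is injective, and it
  is an isomorphism as soon as it is surjective (lemma \<open>pervin_iso_if_bij\<close>). Both parts
  therefore ask which points of a space can be added or removed without changing the lattice.

  (a) Such a map \<open>f : (X, S) \<rightarrow> (Y, T)\<close> is a dense extremal monomorphism between the
  symmetrizations. Each point of an open set of the symmetrized topology lies in a difference \<open>A - C\<close>
  of members of \<open>T\<close> contained in that set (lemma \<open>symmetrization_open_contains_difference\<close>), and
  \<open>A - C\<close> misses \<open>f[X]\<close> only if \<open>f\<^sup>-\<^sup>1(A) \<subseteq> f\<^sup>-\<^sup>1(C)\<close>, that is, \<open>A \<subseteq> C\<close>; so injectivity of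
  the preimage map on \<open>T\<close> makes the image dense. Conversely, if \<open>g\<close> is a dense extremal monomorphism from
  the symmetrization of \<open>(X, S)\<close> to a symmetric \<open>T\<^sub>0\<close> space \<open>(Y, U)\<close>, then preimage is an isomorphism of
  Boolean algebras from \<open>U\<close> to the symmetrization of \<open>S\<close>. Under it \<open>S\<close> corresponds to a sublattice \<open>T\<close>
  of \<open>U\<close> that generates \<open>U\<close>; therefore \<open>T\<close> still separates points (lemma
  \<open>T0_restrict_to_generators\<close>), and \<open>g : (X, S) \<rightarrow> (Y, T)\<close> induces an isomorphism of lattices. Both
  directions thus turn the surjectivity of one map into that of the other.

  (b) A point \<open>x\<close> can be removed without changing the lattice exactly if no two members of \<open>S\<close> differ
  only in \<open>x\<close>, and \<open>T\<^sub>D\<close> says that there is no such point. Under \<open>T\<^sub>D\<close> every point must therefore be a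
  value of \<open>f\<close>; without it the inclusion of a subspace \<open>X - {x}\<close> is a counterexample.
\<close>

section \<open>Separation of points and isomorphisms\<close>

lemma pervin_T0I:
  assumes ps: "pervin_space Y T"
    and sep: "\<And>x y. x \<in> Y \<Longrightarrow> y \<in> Y \<Longrightarrow> \<forall>B\<in>T. x \<in> B \<longleftrightarrow> y \<in> B \<Longrightarrow> x = y"
  shows "pervin_T0 Y T"
  unfolding pervin_T0_def t0_space_def
proof (intro conjI ballI impI ps)
  fix x y
  assume "x \<in> topspace (topology_generated_by T)" "y \<in> topspace (topology_generated_by T)"
    and ne: "x \<noteq> y"
  then have "x \<in> Y" "y \<in> Y"
    using ps by (simp_all add: pervin_space_Union)
  with ne obtain B where "B \<in> T" "(x \<in> B) \<noteq> (y \<in> B)"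
    using sep[of x y] by blast
  then show "\<exists>U. openin (topology_generated_by T) U \<and> (x \<notin> U) = (y \<in> U)"
    using topology_generated_by_Basis[of B T] by blast
qed

lemma set_lattice_iso_L_Pervin:
  "set_lattice_iso T S (L_Pervin X f) \<longleftrightarrow> bij_betw (L_Pervin X f) T S"
  by (auto simp: set_lattice_iso_def L_Pervin_def)

lemma T0_imp_inj_on:
  assumes "pervin_T0 X S" "\<forall>A\<in>S. \<exists>B\<in>T. A = f -` B \<inter> X"
  shows "inj_on f X"
proof (rule inj_onI)
  fix x y assume xy: "x \<in> X" "y \<in> X" "f x = f y"
  then have "\<forall>A\<in>S. x \<in> A \<longleftrightarrow> y \<in> A"
    using assms(2) by fastforce
  then show "x = y"
    using pervin_T0_separate[OF assms(1)] xy by blast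
qed

lemma pervin_iso_if_bij:
  assumes "pervin_morphism X S Y T f" "bij_betw f X Y" "T \<subseteq> Pow Y"
    and "\<forall>A\<in>S. \<exists>B\<in>T. A = f -` B \<inter> X"
  shows "pervin_iso X S Y T f"
proof -
  have img: "f ` (f -` B \<inter> X) = B" if "B \<in> T" for B
    using assms(2,3) that by (fastforce simp: bij_betw_def)
  have "(`) f ` S = T"
  proof (intro subset_antisym subsetI)
    fix C assume "C \<in> (`) f ` S"
    then show "C \<in> T"
      using assms(4) img by auto
  next
    fix B assume "B \<in> T"
    moreover from this have "f -` B \<inter> X \<in> S"
      using assms(1) by (simp add: pervin_morphism_def)
    ultimately show "B \<in> (`) f ` S"
      using img by (metis imageI)
  qed
  then show ?thesis
    using assms(1,2) by (simp add: pervin_iso_def)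
qed


section \<open>The symmetrization\<close>

lemma subset_symmetrization: "S \<subseteq> pervin_symmetrization X S"
  by (simp add: pervin_symmetrization_def hull_subset)

lemma symmetrization_least:
  assumes "algebra X M" "S \<subseteq> M"
  shows "pervin_symmetrization X S \<subseteq> M"
  unfolding pervin_symmetrization_def using assms by (intro hull_minimal)

lemma algebra_symmetrization:
  assumes "S \<subseteq> Pow X"
  shows "algebra X (pervin_symmetrization X S)"
proof -
  have "pervin_symmetrization X S \<subseteq> Pow X"
    using assms by (intro symmetrization_least algebra_Pow)
  then show ?thesis
    by (auto simp: pervin_symmetrization_def hull_def algebra_iff_Un)
qed

lemma pervin_symmetric_if_algebra:
  assumes "algebra X S"
  shows "pervin_symmetric X S"
proof -
  interpret algebra X S by fact
  show ?thesis
    using assms space_closed by (auto simp: pervin_symmetric_def pervin_space_def)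
qed

lemma pervin_symmetric_symmetrization:
  "pervin_space X S \<Longrightarrow> pervin_symmetric X (pervin_symmetrization X S)"
  by (intro pervin_symmetric_if_algebra algebra_symmetrization) (simp add: pervin_space_def)

lemma pervin_T0_symmetrization:
  assumes "pervin_T0 X S"
  shows "pervin_T0 X (pervin_symmetrization X S)"
proof (rule pervin_T0I)
  show "x = y" if "x \<in> X" "y \<in> X" "\<forall>B\<in>pervin_symmetrization X S. x \<in> B \<longleftrightarrow> y \<in> B" for x y
    using pervin_T0_separate[OF assms that(1,2)] that(3) subset_symmetrization[of S X]
    by (meson subsetD)
  show "pervin_space X (pervin_symmetrization X S)"
    using assms pervin_symmetric_symmetrization[of X S]
    unfolding pervin_T0_def pervin_symmetric_def by blast
qed

text \<open>
  The sets \<open>B\<close> whose preimage lies in a given algebra form an algebra, so it is enough to test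
  the generators.
\<close>

lemma pervin_morphism_symmetrization:
  assumes "pervin_morphism X S Y T f" "pervin_space X S" "pervin_space Y T"
  shows "pervin_morphism X (pervin_symmetrization X S) Y (pervin_symmetrization Y T) f"
proof -
  have fXY: "f \<in> X \<rightarrow> Y"
    using assms(1) by (simp add: pervin_morphism_def)
  interpret S: algebra X "pervin_symmetrization X S"
    using assms(2) by (intro algebra_symmetrization) (simp add: pervin_space_def)
  let ?M = "{B \<in> Pow Y. f -` B \<inter> X \<in> pervin_symmetrization X S}"
  have un: "f -` (A \<union> B) \<inter> X = (f -` A \<inter> X) \<union> (f -` B \<inter> X)" for A B
    by auto
  have compl: "f -` (Y - B) \<inter> X = X - (f -` B \<inter> X)" for B
    using fXY by auto
  have "algebra Y ?M"
    unfolding algebra_iff_Un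
  proof (intro conjI ballI)
    show "Y - B \<in> ?M" if "B \<in> ?M" for B
      using S.compl_sets that unfolding mem_Collect_eq compl by blast
    show "B \<union> C \<in> ?M" if "B \<in> ?M" "C \<in> ?M" for B C
      using S.Un that unfolding mem_Collect_eq un by blast
  qed auto
  moreover have "T \<subseteq> ?M"
  proof
    fix B assume "B \<in> T"
    then have "B \<in> Pow Y" "f -` B \<inter> X \<in> S"
      using assms(1,3) unfolding pervin_morphism_def pervin_space_def by blast+
    then show "B \<in> ?M"
      using subset_symmetrization[of S X] by blast
  qed
  ultimately have "pervin_symmetrization Y T \<subseteq> ?M"
    by (rule symmetrization_least)
  with fXY show ?thesis
    by (auto simp: pervin_morphism_def)
qed

text \<open>
  The preimages of members of an algebra on \<open>Y\<close> form an algebra on \<open>X\<close>, so it is enough that the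
  generators are preimages.
\<close>

lemma symmetrization_subset_preimages:
  assumes "f \<in> X \<rightarrow> Y" "T \<subseteq> Pow Y" "\<forall>A\<in>S. \<exists>B\<in>T. A = f -` B \<inter> X"
  shows "\<forall>A\<in>pervin_symmetrization X S. \<exists>B\<in>pervin_symmetrization Y T. A = f -` B \<inter> X"
proof -
  interpret T: algebra Y "pervin_symmetrization Y T"
    using assms(2) by (rule algebra_symmetrization)
  let ?M = "(\<lambda>B. f -` B \<inter> X) ` pervin_symmetrization Y T"
  have un: "(f -` A \<inter> X) \<union> (f -` B \<inter> X) = f -` (A \<union> B) \<inter> X" for A B
    by auto
  have compl: "X - (f -` B \<inter> X) = f -` (Y - B) \<inter> X" for B
    using assms(1) by auto
  have "algebra X ?M"
    unfolding algebra_iff_Un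
  proof (intro conjI ballI)
    show "{} \<in> ?M"
      by (rule image_eqI[of _ _ "{}"]) auto
  next
    fix A assume "A \<in> ?M"
    then obtain B where "B \<in> pervin_symmetrization Y T" "A = f -` B \<inter> X"
      by blast
    then show "X - A \<in> ?M"
      using compl[of B] T.compl_sets by blast
  next
    fix A A' assume "A \<in> ?M" "A' \<in> ?M"
    then obtain B B' where "B \<in> pervin_symmetrization Y T" "A = f -` B \<inter> X"
      "B' \<in> pervin_symmetrization Y T" "A' = f -` B' \<inter> X"
      by blast
    then show "A \<union> A' \<in> ?M"
      using un[of B B'] T.Un by blast
  qed blast
  moreover have "S \<subseteq> ?M"
    using assms(3) subset_symmetrization[of T Y] by blast
  ultimately have "pervin_symmetrization X S \<subseteq> ?M"
    by (rule symmetrization_least)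
  then show ?thesis
    by blast
qed

text \<open>
  The sets \<open>B\<close> such that around each point some difference of members of \<open>T\<close> lies inside \<open>B\<close> or
  inside its complement form an algebra containing \<open>T\<close>; here two differences are intersected by
  \<open>(A - C) \<inter> (A' - C') = (A \<inter> A') - (C \<union> C')\<close>. So these differences are a base of the symmetrized
  topology, and the normal form of the members of the generated Boolean algebra is avoided.
\<close>

lemma symmetrization_open_contains_difference:
  assumes ps: "pervin_space Y T"
    and U: "openin (topology_generated_by (pervin_symmetrization Y T)) U" and y: "y \<in> U"
  obtains A C where "A \<in> T" "C \<in> T" "y \<in> A - C" "A - C \<subseteq> U"
proof -
  define loc where "loc y U \<longleftrightarrow> (\<exists>A\<in>T. \<exists>C\<in>T. y \<in> A - C \<and> A - C \<subseteq> U)" for y U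
  have loc_Int: "loc z (V \<inter> W)" if V: "loc z V" and W: "loc z W" for z V W
  proof -
    obtain A C where AC: "A \<in> T" "C \<in> T" "z \<in> A - C" "A - C \<subseteq> V"
      using V unfolding loc_def by blast
    obtain A' C' where AC': "A' \<in> T" "C' \<in> T" "z \<in> A' - C'" "A' - C' \<subseteq> W"
      using W unfolding loc_def by blast
    have "A \<inter> A' \<in> T" "C \<union> C' \<in> T"
      using ps AC AC' by (auto simp: pervin_space_def)
    moreover have "z \<in> (A \<inter> A') - (C \<union> C')" "(A \<inter> A') - (C \<union> C') \<subseteq> V \<inter> W"
      using AC AC' by auto
    ultimately show ?thesis
      unfolding loc_def by (intro bexI conjI)
  qed
  have loc_mono: "loc z W" if "loc z V" "V \<subseteq> W" for z V W
    using that unfolding loc_def by blast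
  have loc_point: "z \<in> V" if "loc z V" for z V
    using that unfolding loc_def by blast
  have space: "{} \<in> T" "Y \<in> T" "T \<subseteq> Pow Y"
    using ps by (auto simp: pervin_space_def)
  let ?M = "{B \<in> Pow Y. \<forall>z\<in>Y. loc z B \<or> loc z (Y - B)}"
  have "algebra Y ?M"
    unfolding algebra_iff_Un
  proof (intro conjI ballI)
    show "{} \<in> ?M"
      using space by (force simp: loc_def)
  next
    fix B assume "B \<in> ?M"
    moreover from this have "Y - (Y - B) = B"
      by auto
    ultimately show "Y - B \<in> ?M"
      by auto
  next
    fix B C assume BC: "B \<in> ?M" "C \<in> ?M"
    have "loc z (B \<union> C) \<or> loc z (Y - (B \<union> C))" if "z \<in> Y" for z
    proof -
      have eq: "(Y - B) \<inter> (Y - C) = Y - (B \<union> C)"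
        by auto
      have "loc z B \<or> loc z (Y - B)" "loc z C \<or> loc z (Y - C)"
        using BC that by auto
      then show ?thesis
        using loc_Int[of z "Y - B" "Y - C", unfolded eq]
          loc_mono[of z B "B \<union> C"] loc_mono[of z C "B \<union> C"] by blast
    qed
    with BC show "B \<union> C \<in> ?M"
      by auto
  qed auto
  moreover have "T \<subseteq> ?M"
  proof
    fix B assume B: "B \<in> T"
    have "loc z B" if "z \<in> B" for z
      using B space that unfolding loc_def by (intro bexI[of _ B] bexI[of _ "{}"]) auto
    moreover have "loc z (Y - B)" if "z \<in> Y" "z \<notin> B" for z
      using B space that unfolding loc_def by (intro bexI[of _ Y] bexI[of _ B]) auto
    ultimately show "B \<in> ?M"
      using B space by blast
  qed
  ultimately have "pervin_symmetrization Y T \<subseteq> ?M"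
    by (rule symmetrization_least)
  then have basic: "loc z B" if "B \<in> pervin_symmetrization Y T" "z \<in> B" for z B
    using that loc_point[of z "Y - B"] by auto
  have "generate_topology_on (pervin_symmetrization Y T) U"
    using U by (simp add: openin_topology_generated_by_iff)
  then have "\<forall>z\<in>U. loc z U"
  proof induction
    case (UN K)
    then show ?case
      using loc_mono[of _ _ "\<Union>K"] by (meson UnionE Union_upper)
  qed (use basic loc_Int in auto)
  with y show ?thesis
    using that unfolding loc_def by blast
qed


section \<open>Dense extremal monomorphisms and lattice isomorphisms\<close>

lemma dense_iff_meets_open:
  assumes "pervin_space Y T" "pervin_morphism X S Y T f"
  shows "pervin_dense X S Y T f \<longleftrightarrow>
    (\<forall>U y. openin (topology_generated_by T) U \<and> y \<in> U \<longrightarrow> (\<exists>x\<in>X. f x \<in> U))"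
proof -
  have top: "topspace (topology_generated_by T) = Y"
    using assms(1) by (simp add: pervin_space_Union)
  have "y \<in> Y" if "openin (topology_generated_by T) U" "y \<in> U" for U y
    using openin_subset[OF that(1)] that(2) top by blast
  moreover have "pervin_dense X S Y T f \<longleftrightarrow>
      (\<forall>y\<in>Y. \<forall>U. y \<in> U \<and> openin (topology_generated_by T) U \<longrightarrow> (\<exists>x\<in>X. f x \<in> U))"
    using assms(2) unfolding pervin_dense_def closure_of_def top by auto
  ultimately show ?thesis
    by meson
qed

text \<open>
  Members of \<open>T\<close> with the same preimage differ only in points outside the image of \<open>f\<close>, and a
  difference of members of a Boolean algebra is open.
\<close>

lemma dense_imp_inj_on_preimage:
  assumes sym: "pervin_symmetric Y T" and dense: "pervin_dense X S Y T f"
  shows "inj_on (L_Pervin X f) T"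
proof -
  interpret T: algebra Y T
    using sym by (simp add: pervin_symmetric_def)
  have meets: "\<exists>x\<in>X. f x \<in> U" if "openin (topology_generated_by T) U" "y \<in> U" for U y
    using dense_iff_meets_open[of Y T X S f] sym dense that
    unfolding pervin_symmetric_def pervin_dense_def by blast
  have "B \<subseteq> C" if "B \<in> T" "C \<in> T" "L_Pervin X f B = L_Pervin X f C" for B C
  proof
    fix y assume "y \<in> B"
    show "y \<in> C"
    proof (rule ccontr)
      assume "y \<notin> C"
      have "B - C \<in> T"
        using that by auto
      then obtain x where "x \<in> X" "f x \<in> B - C"
        using meets[of "B - C" y] topology_generated_by_Basis[of "B - C" T] \<open>y \<in> B\<close> \<open>y \<notin> C\<close>
        by auto
      with that(3) show False
        by (auto simp: L_Pervin_def)
    qed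
  qed
  then show ?thesis
    by (intro inj_onI) (metis subset_antisym)
qed

text \<open>
  A nonempty difference \<open>A - C\<close> makes \<open>A \<inter> C\<close> and \<open>A\<close> two members of \<open>T\<close>; their preimages differ, and
  a point where they differ is mapped into \<open>A - C\<close>.
\<close>

lemma lattice_iso_imp_dense_symmetrization:
  assumes psX: "pervin_space X S" and psY: "pervin_space Y T"
    and mor: "pervin_morphism X S Y T f" and inj: "inj_on (L_Pervin X f) T"
  shows "pervin_dense X (pervin_symmetrization X S) Y (pervin_symmetrization Y T) f"
proof -
  have "\<exists>x\<in>X. f x \<in> U"
    if U: "openin (topology_generated_by (pervin_symmetrization Y T)) U" "y \<in> U" for U y
  proof -
    obtain A C where AC: "A \<in> T" "C \<in> T" "y \<in> A - C" "A - C \<subseteq> U"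
      using symmetrization_open_contains_difference[OF psY U] .
    have "A \<inter> C \<in> T" "A \<inter> C \<noteq> A"
      using AC psY by (auto simp: pervin_space_def)
    then have "L_Pervin X f (A \<inter> C) \<noteq> L_Pervin X f A"
      using inj AC(1) by (auto dest: inj_onD)
    then show ?thesis
      using AC(4) by (auto simp: L_Pervin_def)
  qed
  then have "\<forall>U y. openin (topology_generated_by (pervin_symmetrization Y T)) U \<and> y \<in> U \<longrightarrow>
      (\<exists>x\<in>X. f x \<in> U)"
    by (intro allI impI) (elim conjE)
  moreover have "pervin_space Y (pervin_symmetrization Y T)"
    using pervin_symmetric_symmetrization[OF psY] by (simp add: pervin_symmetric_def)
  ultimately show ?thesis
    using dense_iff_meets_open[OF _ pervin_morphism_symmetrization[OF mor psX psY]] by simp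
qed

lemma complete_imp_lattice_iso_is_iso:
  assumes T0X: "pervin_T0 X S" and compl: "pervin_complete X S"
    and T0Y: "pervin_T0 Y T" and mor: "pervin_morphism X S Y T f"
    and iso: "set_lattice_iso T S (L_Pervin X f)"
  shows "pervin_iso X S Y T f"
proof -
  have ps: "pervin_space X S" "pervin_space Y T"
    using T0X T0Y by (simp_all add: pervin_T0_def)
  have bij: "bij_betw (L_Pervin X f) T S"
    using iso by (simp add: set_lattice_iso_L_Pervin)
  then have pre: "\<forall>A\<in>S. \<exists>B\<in>T. A = f -` B \<inter> X"
    by (auto simp: bij_betw_def L_Pervin_def)
  have sub: "T \<subseteq> Pow Y"
    using ps by (simp add: pervin_space_def)
  have fXY: "f \<in> X \<rightarrow> Y"
    using mor by (simp add: pervin_morphism_def)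
  let ?S = "pervin_symmetrization X S" and ?T = "pervin_symmetrization Y T"
  have "pervin_dense X ?S Y ?T f"
    using lattice_iso_imp_dense_symmetrization[OF ps mor] bij by (simp add: bij_betw_def)
  moreover have "pervin_extremal_mono X ?S Y ?T f"
    unfolding pervin_extremal_mono_def
    using pervin_morphism_symmetrization[OF mor ps] T0_imp_inj_on[OF T0X pre]
      symmetrization_subset_preimages[OF fXY sub pre] by blast
  ultimately have "pervin_iso X ?S Y ?T f"
    using compl pervin_T0_symmetrization[OF T0Y] pervin_symmetric_symmetrization[OF ps(2)]
    unfolding pervin_complete_def by (intro pervin_complete_symmetric_any_type)
  then show ?thesis
    using pervin_iso_if_bij[OF mor _ sub pre] by (simp add: pervin_iso_def)
qed

text \<open>
  Preimage is a Boolean isomorphism from \<open>U\<close> to the symmetrization of \<open>S\<close>. The members of \<open>U\<close> that do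
  not separate two given points form an algebra; if it contains all members whose preimage is in \<open>S\<close>,
  its preimages exhaust the symmetrization of \<open>S\<close>, and so it is \<open>U\<close>.
\<close>

lemma T0_restrict_to_generators:
  assumes psX: "pervin_space X S" and T0: "pervin_T0 Y U" and sym: "pervin_symmetric Y U"
    and dense: "pervin_dense X (pervin_symmetrization X S) Y U g"
    and pre: "\<forall>A\<in>S. \<exists>B\<in>U. A = g -` B \<inter> X"
  shows "pervin_T0 Y {B \<in> U. g -` B \<inter> X \<in> S}"
proof -
  let ?T = "{B \<in> U. g -` B \<inter> X \<in> S}"
  have mor: "g \<in> X \<rightarrow> Y" "\<forall>B\<in>U. g -` B \<inter> X \<in> pervin_symmetrization X S"
    using dense by (auto simp: pervin_dense_def pervin_morphism_def)
  interpret U: algebra Y U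
    using sym by (simp add: pervin_symmetric_def)
  have un: "g -` (A \<union> B) \<inter> X = (g -` A \<inter> X) \<union> (g -` B \<inter> X)"
    and int: "g -` (A \<inter> B) \<inter> X = (g -` A \<inter> X) \<inter> (g -` B \<inter> X)" for A B
    by auto
  have "g -` Y \<inter> X = X"
    using mor(1) by auto
  then have "pervin_space Y ?T"
    using psX U.space_closed
    by (auto simp: pervin_space_def un int simp del: vimage_Un vimage_Int)
  moreover have "y = z" if yz: "y \<in> Y" "z \<in> Y" "\<forall>B\<in>?T. y \<in> B \<longleftrightarrow> z \<in> B" for y z
  proof -
    let ?N = "{B \<in> U. y \<in> B \<longleftrightarrow> z \<in> B}"
    have "algebra Y ?N"
      using U.space_closed yz(1,2) by (auto simp: algebra_iff_Un)
    then have N: "pervin_symmetrization Y ?N \<subseteq> ?N"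
      by (intro symmetrization_least) auto
    have "?N \<subseteq> Pow Y"
      using U.space_closed by auto
    moreover have "\<forall>A\<in>S. \<exists>B\<in>?N. A = g -` B \<inter> X"
    proof
      fix A assume "A \<in> S"
      moreover from this obtain B where "B \<in> U" "A = g -` B \<inter> X"
        using pre by blast
      moreover from calculation have "y \<in> B \<longleftrightarrow> z \<in> B"
        using yz(3) by simp
      ultimately show "\<exists>B\<in>?N. A = g -` B \<inter> X"
        by (intro bexI[of _ B]) simp_all
    qed
    ultimately have
      N_pre: "\<forall>A\<in>pervin_symmetrization X S. \<exists>B\<in>pervin_symmetrization Y ?N. A = g -` B \<inter> X"
      by (intro symmetrization_subset_preimages mor(1))
    have "B \<in> ?N" if B: "B \<in> U" for B
    proof -
      have "g -` B \<inter> X \<in> pervin_symmetrization X S"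
        using mor(2) B by blast
      then obtain C where C: "C \<in> ?N" "g -` B \<inter> X = g -` C \<inter> X"
        using N_pre N by blast
      then have "L_Pervin X g B = L_Pervin X g C"
        by (simp add: L_Pervin_def)
      then have "B = C"
        using dense_imp_inj_on_preimage[OF sym dense] B C(1) by (blast dest: inj_onD)
      with C(1) show ?thesis
        by simp
    qed
    then show ?thesis
      using pervin_T0_separate[OF T0 yz(1,2)] by blast
  qed
  ultimately show ?thesis
    by (rule pervin_T0I)
qed

lemma pervin_T0_transport:
  assumes "pervin_T0 Y T" "inj_on p Y"
  shows "pervin_T0 (p ` Y) ((`) p ` T)"
proof -
  have "pervin_space Y T"
    using assms(1) by (simp add: pervin_T0_def)
  from pervin_transport(1,2)[OF this assms(2)] show ?thesis
    using assms(1) homeomorphic_t0_space[OF homeomorphic_map_imp_homeomorphic_space]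
    unfolding pervin_T0_def by blast
qed

text \<open>
  The hypothesis is applied to the codomain with the smaller lattice of all members whose preimage is
  in \<open>S\<close>, copied into the type of the test carriers. It gives surjectivity, which does not depend on
  the lattice and makes the original extremal monomorphism an isomorphism.
\<close>

lemma complete_if_lattice_isos_are_isos:
  fixes X :: "'a set" and S :: "'a set set"
  assumes psX: "pervin_space X S"
    and test: "\<And>(Y :: ('a, 'u) test_type set) T f. pervin_T0 Y T \<Longrightarrow> pervin_morphism X S Y T f \<Longrightarrow>
      set_lattice_iso T S (L_Pervin X f) \<Longrightarrow> pervin_iso X S Y T f"
  shows "pervin_complete X S"
  unfolding pervin_complete_def pervin_complete_symmetric_def
proof (intro allI impI, elim conjE)
  fix Y :: "'a set set set" and U g
  let ?S = "pervin_symmetrization X S"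
  assume T0: "pervin_T0 Y U" and sym: "pervin_symmetric Y U"
    and dense: "pervin_dense X ?S Y U g" and ext: "pervin_extremal_mono X ?S Y U g"
  have pre: "\<forall>A\<in>?S. \<exists>B\<in>U. A = g -` B \<inter> X" and gmor: "pervin_morphism X ?S Y U g"
    and inj: "inj_on g X"
    using ext by (auto simp: pervin_extremal_mono_def)
  have gXY: "g \<in> X \<rightarrow> Y"
    using gmor by (simp add: pervin_morphism_def)
  have sub: "U \<subseteq> Pow Y"
    using sym by (simp add: pervin_symmetric_def pervin_space_def)
  let ?T = "{B \<in> U. g -` B \<inter> X \<in> S}"
  let ?p = "Inl :: _ \<Rightarrow> ('a, 'u) test_type"
  have preS: "\<forall>A\<in>S. \<exists>B\<in>U. A = g -` B \<inter> X"
    using pre subset_symmetrization[of S X] by blast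
  have vim: "(?p \<circ> g) -` (?p ` B) \<inter> X = g -` B \<inter> X" for B
    by auto
  have "pervin_T0 (?p ` Y) ((`) ?p ` ?T)"
    by (intro pervin_T0_transport T0_restrict_to_generators[OF psX T0 sym dense preS]) simp
  moreover have "pervin_morphism X S (?p ` Y) ((`) ?p ` ?T) (?p \<circ> g)"
    using gXY vim by (auto simp: pervin_morphism_def)
  moreover have "set_lattice_iso ((`) ?p ` ?T) S (L_Pervin X (?p \<circ> g))"
    unfolding set_lattice_iso_L_Pervin bij_betw_def
  proof
    have "inj_on (L_Pervin X g) ?T"
      using dense_imp_inj_on_preimage[OF sym dense] by (rule inj_on_subset) auto
    then show "inj_on (L_Pervin X (?p \<circ> g)) ((`) ?p ` ?T)"
      by (auto simp add: inj_on_def L_Pervin_def vim simp del: vimage_comp)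
    show "L_Pervin X (?p \<circ> g) ` ((`) ?p ` ?T) = S"
      unfolding image_image L_Pervin_def vim using preS by auto
  qed
  ultimately have "pervin_iso X S (?p ` Y) ((`) ?p ` ?T) (?p \<circ> g)"
    by (rule test)
  then have "?p ` g ` X = ?p ` Y"
    by (simp add: pervin_iso_def bij_betw_def image_comp)
  then have "g ` X = Y"
    by (simp add: inj_image_eq_iff)
  with inj show "pervin_iso X ?S Y U g"
    by (intro pervin_iso_if_bij[OF gmor _ sub pre]) (simp add: bij_betw_def)
qed


section \<open>The \<open>T\<^sub>D\<close> condition\<close>

text \<open>
  The members \<open>A\<close> and \<open>A - {x}\<close> of \<open>S\<close> have different preimages, so \<open>x\<close> is a value of \<open>f\<close>.
\<close>

lemma TD_imp_lattice_iso_is_iso: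
  assumes TD: "pervin_TD X S" and psX: "pervin_space X S" and T0Y: "pervin_T0 Y T"
    and mor: "pervin_morphism Y T X S f" and iso: "set_lattice_iso S T (L_Pervin Y f)"
  shows "pervin_iso Y T X S f"
proof -
  have bij: "bij_betw (L_Pervin Y f) S T"
    using iso by (simp add: set_lattice_iso_L_Pervin)
  then have pre: "\<forall>A\<in>T. \<exists>B\<in>S. A = f -` B \<inter> Y"
    by (auto simp: bij_betw_def L_Pervin_def)
  have "x \<in> f ` Y" if x: "x \<in> X" for x
  proof -
    obtain A where "A \<in> S" "x \<in> A" "A - {x} \<in> S"
      using TD x unfolding pervin_TD_def by blast
    moreover from this have "L_Pervin Y f A \<noteq> L_Pervin Y f (A - {x})"
      using bij by (auto simp: bij_betw_def dest: inj_onD)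
    ultimately show ?thesis
      by (auto simp: L_Pervin_def)
  qed
  then have "bij_betw f Y X"
    using T0_imp_inj_on[OF T0Y pre] mor by (auto simp: bij_betw_def pervin_morphism_def)
  then show ?thesis
    using pervin_iso_if_bij[OF mor _ _ pre] psX by (simp add: pervin_space_def)
qed

text \<open>
  If \<open>T\<^sub>D\<close> fails at \<open>x\<close>, then \<open>A \<mapsto> A - {x}\<close> is injective on \<open>S\<close>: a member containing \<open>x\<close> and a
  different one without \<open>x\<close>, equal outside \<open>x\<close>, would be \<open>A\<close> and \<open>A - {x}\<close>. Hence the inclusion
  of the subspace \<open>X - {x}\<close> induces an isomorphism of lattices without being surjective.
\<close>

lemma TD_if_lattice_isos_are_isos:
  fixes X :: "'a set" and S :: "'a set set"
  assumes T0X: "pervin_T0 X S"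
    and test: "\<And>(Y :: ('a, 'u) test_type set) T f. pervin_T0 Y T \<Longrightarrow> pervin_morphism Y T X S f \<Longrightarrow>
      set_lattice_iso S T (L_Pervin Y f) \<Longrightarrow> pervin_iso Y T X S f"
  shows "pervin_TD X S"
proof (rule ccontr)
  assume "\<not> pervin_TD X S"
  then obtain x where x: "x \<in> X" "\<And>A. A \<in> S \<Longrightarrow> x \<in> A \<Longrightarrow> A - {x} \<notin> S"
    unfolding pervin_TD_def by blast
  have ps: "pervin_space X S"
    using T0X by (simp add: pervin_T0_def)
  have sub: "A \<subseteq> X" if "A \<in> S" for A
    using ps that by (auto simp: pervin_space_def)
  \<comment> \<open>Any injection into the type of the test carriers would do; the subspace is copied along it.\<close>
  define p :: "'a \<Rightarrow> ('a, 'u) test_type" where "p a = Inl {{a}}" for a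
  have inj: "inj p"
    by (auto simp: inj_def p_def)
  let ?Y = "X - {x}" and ?T = "(\<lambda>A. A - {x}) ` S"
  have un: "(A - {x}) \<union> (B - {x}) = (A \<union> B) - {x}"
    and int: "(A - {x}) \<inter> (B - {x}) = (A \<inter> B) - {x}" for A B
    by auto
  have "pervin_space ?Y ?T"
    using ps unfolding pervin_space_def by (auto simp: un int)
  moreover have "y = z" if yz: "y \<in> ?Y" "z \<in> ?Y" "\<forall>B\<in>?T. y \<in> B \<longleftrightarrow> z \<in> B" for y z
    using pervin_T0_separate[OF T0X, of y z] yz by auto
  ultimately have "pervin_T0 ?Y ?T"
    by (rule pervin_T0I)
  then have "pervin_T0 (p ` ?Y) ((`) p ` ?T)"
    using inj by (intro pervin_T0_transport) (auto intro: inj_on_subset)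
  moreover have vim: "inv p -` A \<inter> p ` ?Y = p ` (A - {x})" if "A \<in> S" for A
    using inj sub[OF that] by auto
  have "pervin_morphism (p ` ?Y) ((`) p ` ?T) X S (inv p)"
    using inj vim by (auto simp: pervin_morphism_def)
  moreover have "set_lattice_iso S ((`) p ` ?T) (L_Pervin (p ` ?Y) (inv p))"
    unfolding set_lattice_iso_L_Pervin bij_betw_def
  proof
    have "A \<subseteq> B" if "A \<in> S" "B \<in> S" "A - {x} = B - {x}" for A B
    proof (rule ccontr)
      assume "\<not> A \<subseteq> B"
      with that(3) have "x \<in> A" "B = A - {x}"
        by auto
      with x(2)[OF that(1)] that(2) show False
        by simp
    qed
    then have "inj_on (\<lambda>A. A - {x}) S"
      by (intro inj_onI) (metis subset_antisym)
    then show "inj_on (L_Pervin (p ` ?Y) (inv p)) S"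
      using vim inj by (simp add: inj_on_def L_Pervin_def inj_image_eq_iff)
    show "L_Pervin (p ` ?Y) (inv p) ` S = (`) p ` ?T"
      using vim by (auto simp: L_Pervin_def image_image)
  qed
  ultimately have "pervin_iso (p ` ?Y) ((`) p ` ?T) X S (inv p)"
    by (rule test)
  then have "inv p ` p ` ?Y = X"
    by (simp add: pervin_iso_def bij_betw_def)
  then have "X - {x} = X"
    using inj by (simp add: image_inv_f_f)
  with x(1) show False
    by auto
qed

theorem proposition6p4:
  fixes X :: "'a set" and S :: "'a set set"
  assumes "pervin_space X S" and "pervin_T0 X S"
  shows
    "(pervin_complete X S \<longleftrightarrow>
        (\<forall>(Y :: ('a, 'u) test_type set) T f.
           pervin_space Y T \<and> pervin_T0 Y T \<and> pervin_morphism X S Y T f \<and>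
           set_lattice_iso T S (L_Pervin X f) \<longrightarrow> pervin_iso X S Y T f))
     \<and>
     (pervin_TD X S \<longleftrightarrow>
        (\<forall>(Y :: ('a, 'u) test_type set) T f.
           pervin_space Y T \<and> pervin_T0 Y T \<and> pervin_morphism Y T X S f \<and>
           set_lattice_iso S T (L_Pervin Y f) \<longrightarrow> pervin_iso Y T X S f))"
    (is "(_ \<longleftrightarrow> ?a) \<and> (_ \<longleftrightarrow> ?b)")
proof (intro conjI iffI)
  show ?a if "pervin_complete X S"
    using complete_imp_lattice_iso_is_iso[OF assms(2) that] by blast
  show "pervin_complete X S" if ?a
    using that by (intro complete_if_lattice_isos_are_isos[OF assms(1)]) (auto simp: pervin_T0_def)
  show ?b if "pervin_TD X S"
    using TD_imp_lattice_iso_is_iso[OF that assms(1)] by blast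
  show "pervin_TD X S" if ?b
    using that by (intro TD_if_lattice_isos_are_isos[OF assms(2)]) (auto simp: pervin_T0_def)
qed

end
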